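(* Let $\mathbb T=(T,\eta^{T},\mu^{T})$ be a monad in the category $\mathbf{Comp}$ of compact Hausdorff spaces and continuous maps. Each binary right-topological operation $\varphi:X\times Y\to Z$ in the category $\mathbf{Tych}$ of Tychonoff spaces and continuous maps (that is, with $X,Y,Z$ Tychonoff spaces), with discrete $X$, can be extended to a right-topological operation $\Phi:T\beta X\times T\beta Y\to T\beta Z$ that contains the set $\eta(X)\subset T\beta X$ in its topological center $\Lambda_\Phi$. If the functor $T$ is continuous, then the set $T_fX$ of elements $a\in T\beta X$ with finite support is dense in $T\beta X$ and lies in the topological center $\Lambda_\Phi$ of the operation $\Phi$. Moreover, if $X=Y=Z$ and the operation $\varphi$ is associative, then so is the operation $\Phi$.
   Context: $\beta X$ denotes the Stone–Čech compactification of a Tychonoff space $X$, and $\beta$ is regarded as a functor from $\mathbf{Tych}$ to $\mathbf{Comp}$; $T\beta$ is the composition of $\beta:\mathbf{Tych}\to\mathbf{Comp}$ with $T:\mathbf{Comp}\to\mathbf{Comp}$. For a Tychonoff space $X$, $\eta=\eta_X:X\to T\beta X$ denotes the composition of the canonical embedding $X\to\beta X$ with the component $\eta^{T}_{\beta X}:\beta X\to T\beta X$ of the unit of the monad $\mathbb T$. That $\Phi$ extends $\varphi$ means that $\Phi(\eta(x),\eta(y))=\eta(\varphi(x,y))$ for all $x\in X$, $y\in Y$. A binary operation $\varphi:X\times Y\to Z$ between topological spaces is any function. It is right-topological if for every $y\in Y$ the right shift $X\to Z$, $x\mapsto\varphi(x,y)$, is continuous. The topological center $\Lambda_\varphi$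 of a right-topological operation $\varphi$ is the set of all $x\in X$ such that the left shift $Y\to Z$, $y\mapsto\varphi(x,y)$, is continuous. An operation $\varphi:X\times X\to X$ is associative if $\varphi(\varphi(x,y),z)=\varphi(x,\varphi(y,z))$ for all $x,y,z\in X$. The functor $T:\mathbf{Comp}\to\mathbf{Comp}$ is continuous if for all compact Hausdorff spaces $K,Z$ the map $\mathrm{Mor}(K,Z)\to\mathrm{Mor}(TK,TZ)$, $f\mapsto Tf$, is continuous, where the sets of continuous maps carry the compact-open topology. An element $a\in T\beta X$ has finite support if there are a finite discrete space $D$ and a map $f:D\to X$ such that $a\in T\beta f(T\beta D)$ (note $\beta D=D$). $T_fX\subset T\beta X$ is the set of all elements with finite support.
   Formalization: The formal theorem additionally assumes that every left shift y ↦ φ(x,y), x in X, is continuous; without this the claim fails (identity monad, X a point, Y=[0,1], Z={0,1}, φ( *,y)=1 iff y=0). *)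

theory Defs
  imports "HOL-Analysis.Analysis" "HOL-Library.Equipollence" "HOL-Library.FuncSet"
begin

text \<open>
  The categories of Tychonoff and of compact Hausdorff spaces are taken relative to a universe of
  small sets: a type \<open>'u\<close> whose cardinality is a strong limit, a set being small if it has fewer
  elements than \<open>'u\<close>. The strong limit property makes the small sets closed under power sets, so
  that a small Tychonoff space has a small Stone-Cech compactification.
\<close>

definition strong_limit_universe :: "'u itself \<Rightarrow> bool" where
  "strong_limit_universe _ \<longleftrightarrow>
     (\<forall>A :: 'u set. A \<prec> (UNIV :: 'u set) \<longrightarrow> Pow A \<prec> (UNIV :: 'u set))"

definition small_space :: "'u topology \<Rightarrow> bool" where
  "small_space X \<longleftrightarrow> topspace X \<prec> (UNIV :: 'u set)"

definition tych_object :: "'u topology \<Rightarrow> bool" where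
  "tych_object X \<longleftrightarrow> small_space X \<and> completely_regular_space X \<and> Hausdorff_space X"

definition comp_object :: "'u topology \<Rightarrow> bool" where
  "comp_object K \<longleftrightarrow> small_space K \<and> compact_space K \<and> Hausdorff_space K"

text \<open>
  A morphism is a continuous map normalised outside its domain by \<^const>\<open>extensional\<close>, so that
  equality of morphisms is equality of functions; identities and composites are accordingly formed
  with \<^const>\<open>restrict\<close> and \<^const>\<open>compose\<close>.
\<close>

definition mor :: "'u topology \<Rightarrow> 'v topology \<Rightarrow> ('u \<Rightarrow> 'v) set" where
  "mor K L = {f \<in> extensional (topspace K). continuous_map K L f}"

definition id_mor :: "'u topology \<Rightarrow> 'u \<Rightarrow> 'u" where
  "id_mor K = restrict id (topspace K)"

definition comp_functor ::
  "('u topology \<Rightarrow> 'u topology) \<Rightarrow>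
   ('u topology \<Rightarrow> 'u topology \<Rightarrow> ('u \<Rightarrow> 'u) \<Rightarrow> 'u \<Rightarrow> 'u) \<Rightarrow> bool" where
  "comp_functor T Tm \<longleftrightarrow>
     (\<forall>K. comp_object K \<longrightarrow> comp_object (T K)) \<and>
     (\<forall>K L f. comp_object K \<and> comp_object L \<and> f \<in> mor K L \<longrightarrow> Tm K L f \<in> mor (T K) (T L)) \<and>
     (\<forall>K. comp_object K \<longrightarrow> Tm K K (id_mor K) = id_mor (T K)) \<and>
     (\<forall>K L M f g. comp_object K \<and> comp_object L \<and> comp_object M \<and> f \<in> mor K L \<and> g \<in> mor L M
        \<longrightarrow> Tm K M (compose (topspace K) g f)
            = compose (topspace (T K)) (Tm L M g) (Tm K L f))"

definition comp_monad ::
  "('u topology \<Rightarrow> 'u topology) \<Rightarrow>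
   ('u topology \<Rightarrow> 'u topology \<Rightarrow> ('u \<Rightarrow> 'u) \<Rightarrow> 'u \<Rightarrow> 'u) \<Rightarrow>
   ('u topology \<Rightarrow> 'u \<Rightarrow> 'u) \<Rightarrow> ('u topology \<Rightarrow> 'u \<Rightarrow> 'u) \<Rightarrow> bool" where
  "comp_monad T Tm \<eta> \<mu> \<longleftrightarrow>
     comp_functor T Tm \<and>
     (\<forall>K. comp_object K \<longrightarrow> \<eta> K \<in> mor K (T K) \<and> \<mu> K \<in> mor (T (T K)) (T K)) \<and>
     (\<forall>K L f. comp_object K \<and> comp_object L \<and> f \<in> mor K L \<longrightarrow>
        compose (topspace K) (\<eta> L) f = compose (topspace K) (Tm K L f) (\<eta> K) \<and>
        compose (topspace (T (T K))) (\<mu> L) (Tm (T K) (T L) (Tm K L f))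
          = compose (topspace (T (T K))) (Tm K L f) (\<mu> K)) \<and>
     (\<forall>K. comp_object K \<longrightarrow>
        compose (topspace (T K)) (\<mu> K) (\<eta> (T K)) = id_mor (T K) \<and>
        compose (topspace (T K)) (\<mu> K) (Tm K (T K) (\<eta> K)) = id_mor (T K) \<and>
        compose (topspace (T (T (T K)))) (\<mu> K) (\<mu> (T K))
          = compose (topspace (T (T (T K)))) (\<mu> K) (Tm (T (T K)) (T K) (\<mu> K)))"

definition compact_open_topology :: "'u topology \<Rightarrow> 'v topology \<Rightarrow> ('u \<Rightarrow> 'v) topology" where
  "compact_open_topology K L =
     topology_generated_by {{f \<in> mor K L. f ` C \<subseteq> U} | C U. compactin K C \<and> openin L U}"

definition continuous_comp_functor ::
  "('u topology \<Rightarrow> 'u topology) \<Rightarrow>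
   ('u topology \<Rightarrow> 'u topology \<Rightarrow> ('u \<Rightarrow> 'u) \<Rightarrow> 'u \<Rightarrow> 'u) \<Rightarrow> bool" where
  "continuous_comp_functor T Tm \<longleftrightarrow>
     (\<forall>K Z. comp_object K \<and> comp_object Z \<longrightarrow>
        continuous_map (compact_open_topology K Z) (compact_open_topology (T K) (T Z)) (Tm K Z))"

text \<open>
  \<open>B\<close> with the embedding \<open>e\<close> is a Stone-Cech compactification of \<open>X\<close>: a compactification to which
  every continuous map from \<open>X\<close> to a compact Hausdorff space extends.
\<close>

definition stone_cech_compactification ::
  "'u topology \<Rightarrow> 'u topology \<Rightarrow> ('u \<Rightarrow> 'u) \<Rightarrow> bool" where
  "stone_cech_compactification X B e \<longleftrightarrow>
     comp_object B \<and> embedding_map X B e \<and> B closure_of (e ` topspace X) = topspace B \<and>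
     (\<forall>(K :: 'u topology) f. comp_object K \<and> continuous_map X K f \<longrightarrow>
        (\<exists>g. continuous_map B K g \<and> (\<forall>x \<in> topspace X. g (e x) = f x)))"

text \<open>
  Since \<open>\<beta>X\<close> is determined only up to homeomorphism over \<open>X\<close>, the object part \<open>\<beta>\<close> and the canonical
  embeddings \<open>\<iota> X\<close> are an arbitrary choice of compactifications; \<open>stone_cech_map\<close> is the
  action on morphisms.
\<close>

definition stone_cech_choice ::
  "('u topology \<Rightarrow> 'u topology) \<Rightarrow> ('u topology \<Rightarrow> 'u \<Rightarrow> 'u) \<Rightarrow> bool" where
  "stone_cech_choice \<beta> \<iota> \<longleftrightarrow>
     (\<forall>X. tych_object X \<longrightarrow> stone_cech_compactification X (\<beta> X) (\<iota> X))"

definition stone_cech_map ::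
  "('u topology \<Rightarrow> 'u topology) \<Rightarrow> ('u topology \<Rightarrow> 'u \<Rightarrow> 'u) \<Rightarrow>
   'u topology \<Rightarrow> 'u topology \<Rightarrow> ('u \<Rightarrow> 'u) \<Rightarrow> 'u \<Rightarrow> 'u" where
  "stone_cech_map \<beta> \<iota> X Y f =
     (THE g. g \<in> mor (\<beta> X) (\<beta> Y) \<and> (\<forall>x \<in> topspace X. g (\<iota> X x) = \<iota> Y (f x)))"

definition unit_map ::
  "('u topology \<Rightarrow> 'u topology) \<Rightarrow> ('u topology \<Rightarrow> 'u \<Rightarrow> 'u) \<Rightarrow>
   ('u topology \<Rightarrow> 'u \<Rightarrow> 'u) \<Rightarrow> 'u topology \<Rightarrow> 'u \<Rightarrow> 'u" where
  "unit_map \<beta> \<iota> \<eta> X x = \<eta> (\<beta> X) (\<iota> X x)"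

definition finite_support ::
  "('u topology \<Rightarrow> 'u topology) \<Rightarrow>
   ('u topology \<Rightarrow> 'u topology \<Rightarrow> ('u \<Rightarrow> 'u) \<Rightarrow> 'u \<Rightarrow> 'u) \<Rightarrow>
   ('u topology \<Rightarrow> 'u topology) \<Rightarrow> ('u topology \<Rightarrow> 'u \<Rightarrow> 'u) \<Rightarrow> 'u topology \<Rightarrow> 'u set" where
  "finite_support T Tm \<beta> \<iota> X =
     {a \<in> topspace (T (\<beta> X)). \<exists>S f. finite S \<and> f \<in> S \<rightarrow> topspace X \<and>
        (let D = discrete_topology S
         in a \<in> Tm (\<beta> D) (\<beta> X) (stone_cech_map \<beta> \<iota> D X f) ` topspace (T (\<beta> D)))}"

definition right_topological ::
  "'a topology \<Rightarrow> 'b topology \<Rightarrow> 'c topology \<Rightarrow> ('a \<Rightarrow> 'b \<Rightarrow> 'c) \<Rightarrow> bool" where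
  "right_topological X Y Z \<phi> \<longleftrightarrow> (\<forall>y \<in> topspace Y. continuous_map X Z (\<lambda>x. \<phi> x y))"

definition topological_center ::
  "'a topology \<Rightarrow> 'b topology \<Rightarrow> 'c topology \<Rightarrow> ('a \<Rightarrow> 'b \<Rightarrow> 'c) \<Rightarrow> 'a set" where
  "topological_center X Y Z \<phi> = {x \<in> topspace X. continuous_map Y Z (\<lambda>y. \<phi> x y)}"

definition associative_on :: "'a set \<Rightarrow> ('a \<Rightarrow> 'a \<Rightarrow> 'a) \<Rightarrow> bool" where
  "associative_on A \<phi> \<longleftrightarrow> (\<forall>x \<in> A. \<forall>y \<in> A. \<forall>z \<in> A. \<phi> (\<phi> x y) z = \<phi> x (\<phi> y z))"

end

theory Submission
  imports Defs
begin

text \<open>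
  For \<open>b \<in> T\<beta>Y\<close> the map \<open>x \<mapsto> T\<beta>(\<phi> x)(b)\<close> is continuous on the discrete space \<open>X\<close> and extends to
  \<open>g\<^sub>b : \<beta>X \<rightarrow> T\<beta>Z\<close>; put \<open>\<Phi>(a, b) = \<mu>(T g\<^sub>b a)\<close>, the Kleisli extension of \<open>g\<^sub>b\<close>. The right shifts are
  then homomorphisms of free algebras, hence determined by their values on \<open>\<eta>(X)\<close>, which gives
  associativity. If \<open>T\<close> is continuous and \<open>a = T\<beta>f(c)\<close> with \<open>f\<close> defined on a finite discrete space \<open>D\<close>,
  then \<open>\<Phi>(a, b) = \<mu>(T(g\<^sub>b \<circ> \<beta>f)(c))\<close>, and \<open>b \<mapsto> g\<^sub>b \<circ> \<beta>f\<close> is continuous for the compact-open topology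
  since it is pointwise continuous and \<open>\<beta>D\<close> is finite. Density holds because the identity of \<open>\<beta>X\<close>
  is a limit of maps factoring through finite subsets of \<open>X\<close>.
\<close>

section \<open>Small spaces and morphisms\<close>

lemma lesspoll_iff_card_less: "finite A \<Longrightarrow> finite B \<Longrightarrow> A \<prec> B \<longleftrightarrow> card A < card B"
  by (auto simp: lesspoll_def lepoll_iff_card_le eqpoll_iff_card)

text \<open>If there were only \<open>n\<close> elements, the complement of one point would have
  \<open>2 ^ (n - 1)\<close> subsets, and the strong limit property would make this less than
  \<open>n\<close>.\<close>

lemma strong_limit_universe_infinite:
  assumes "strong_limit_universe TYPE('u)"
  shows "infinite (UNIV :: 'u set)"
proof
  assume fin: "finite (UNIV :: 'u set)"
  define A :: "'u set" where "A = UNIV - {undefined}"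
  have "A \<prec> (UNIV :: 'u set)"
    using fin by (simp add: A_def lesspoll_iff_card_less card_gt_0_iff)
  then have "Pow A \<prec> (UNIV :: 'u set)"
    using assms unfolding strong_limit_universe_def by blast
  then have "card (Pow A) < card (UNIV :: 'u set)"
    using fin lesspoll_iff_card_less[of "Pow A" "UNIV :: 'u set"] by (simp add: A_def)
  moreover have "card (UNIV :: 'u set) = Suc (card A)"
    unfolding A_def using fin by (metis UNIV_I card.remove)
  moreover have "card A < 2 ^ card A"
    by (rule less_exp)
  ultimately show False
    using finite_subset[OF subset_UNIV fin, of A] by (simp add: card_Pow)
qed

text \<open>Finite sets are small because the universe is infinite. This makes the spaces
  \<open>D\<close> in the definition of finite support objects to which \<beta> applies.\<close>

lemma tych_object_finite_discrete:
  assumes "strong_limit_universe TYPE('u)" "finite (S :: 'u set)"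
  shows "tych_object (discrete_topology S)"
  using assms strong_limit_universe_infinite finite_lesspoll_infinite
  by (auto simp: tych_object_def small_space_def completely_regular_space_discrete_topology)

lemma mor_cont: "f \<in> mor K L \<Longrightarrow> continuous_map K L f"
  by (simp add: mor_def)

lemma mor_in: "f \<in> mor K L \<Longrightarrow> x \<in> topspace K \<Longrightarrow> f x \<in> topspace L"
  by (auto simp: mor_def continuous_map_def)

lemma mor_restrict: "continuous_map K L f \<Longrightarrow> restrict f (topspace K) \<in> mor K L"
  by (auto simp: mor_def intro: continuous_map_eq)

lemma mor_eqI: "f \<in> mor K L \<Longrightarrow> g \<in> mor K L \<Longrightarrow> (\<And>x. x \<in> topspace K \<Longrightarrow> f x = g x) \<Longrightarrow> f = g"
  by (auto simp: mor_def intro: extensionalityI)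

lemma mor_compose: "f \<in> mor K L \<Longrightarrow> g \<in> mor L M \<Longrightarrow> compose (topspace K) g f \<in> mor K M"
  unfolding mor_def
  by (auto intro!: continuous_map_eq[OF continuous_map_compose[of K L f M g]] simp: compose_def)

lemma id_mor_mor: "id_mor K \<in> mor K K"
  unfolding id_mor_def by (intro mor_restrict) simp

section \<open>The compact-open topology\<close>

text \<open>Induction on the generation of \<open>U\<close>: a binary intersection merges two finite
  families, and a union inherits the family of a member containing \<open>x\<close>.\<close>

lemma generate_topology_on_finite_Inter:
  assumes "generate_topology_on \<S> U" "x \<in> U"
  shows "\<exists>\<F>. finite \<F> \<and> \<F> \<subseteq> \<S> \<and> x \<in> \<Inter>\<F> \<and> \<Inter>\<F> \<subseteq> U"
  using assms
proof (induction arbitrary: x)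
  case (Int a b)
  then obtain \<F> \<G> where "finite \<F>" "\<F> \<subseteq> \<S>" "x \<in> \<Inter>\<F>" "\<Inter>\<F> \<subseteq> a"
    "finite \<G>" "\<G> \<subseteq> \<S>" "x \<in> \<Inter>\<G>" "\<Inter>\<G> \<subseteq> b"
    by (metis IntE)
  then show ?case
    by (intro exI[of _ "\<F> \<union> \<G>"]) blast
next
  case (UN K)
  then show ?case
    by (meson UnionE Union_upper order_trans)
next
  case (Basis s)
  then show ?case
    by (intro exI[of _ "{s}"]) simp
qed simp

lemma topspace_compact_open_topology: "topspace (compact_open_topology K L) = mor K L"
proof -
  \<comment> \<open>With \<open>C\<close> and \<open>U\<close> both empty, \<open>mor K L\<close>
    itself is a subbasic set.\<close>
  have "{f \<in> mor K L. f ` {} \<subseteq> {}} \<in> {{f \<in> mor K L. f ` C \<subseteq> U} | C U. compactin K C \<and> openin L U}"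
    by (intro CollectI exI[of _ "{}"]) simp
  then show ?thesis
    unfolding compact_open_topology_def topology_generated_by_topspace by auto
qed

lemma compact_open_neighbourhood:
  assumes "openin (compact_open_topology K L) \<N>" "f \<in> \<N>"
  obtains I where "finite I"
    "\<forall>i \<in> I. compactin K (fst i) \<and> openin L (snd i) \<and> f ` fst i \<subseteq> snd i"
    "\<forall>g \<in> mor K L. (\<forall>i \<in> I. g ` fst i \<subseteq> snd i) \<longrightarrow> g \<in> \<N>"
proof -
  \<comment> \<open>Subbasic sets are indexed by pairs \<open>(C, U)\<close>, so that a finite
    subfamily comes from a finite set \<open>I\<close> of pairs.\<close>
  define P where "P = {i. compactin K (fst i) \<and> openin L (snd i)}"
  define E where "E i = {f \<in> mor K L. f ` fst i \<subseteq> snd i}" for i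
  have "{{f \<in> mor K L. f ` C \<subseteq> U} | C U. compactin K C \<and> openin L U} = E ` P"
    by (auto simp: E_def P_def image_Collect)
  then have "generate_topology_on (E ` P) \<N>"
    using assms(1) unfolding compact_open_topology_def
    by (simp add: openin_topology_generated_by_iff)
  from generate_topology_on_finite_Inter[OF this assms(2)]
  obtain \<F> where \<F>: "finite \<F>" "\<F> \<subseteq> E ` P" "f \<in> \<Inter>\<F>" "\<Inter>\<F> \<subseteq> \<N>"
    by blast
  from finite_subset_image[OF \<F>(1,2)] obtain I where I: "I \<subseteq> P" "finite I" "\<F> = E ` I"
    by blast
  show thesis
  proof (rule that[OF I(2)])
    show "\<forall>i \<in> I. compactin K (fst i) \<and> openin L (snd i) \<and> f ` fst i \<subseteq> snd i"
      using \<F>(3) I(1,3) by (auto simp: E_def P_def)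
    show "\<forall>g \<in> mor K L. (\<forall>i \<in> I. g ` fst i \<subseteq> snd i) \<longrightarrow> g \<in> \<N>"
      using \<F>(4) I(3) by (auto simp: E_def)
  qed
qed

lemma openin_compact_open:
  "compactin K C \<Longrightarrow> openin L U \<Longrightarrow> openin (compact_open_topology K L) {f \<in> mor K L. f ` C \<subseteq> U}"
  unfolding compact_open_topology_def by (rule topology_generated_by_Basis) blast

lemma openin_evaluation:
  assumes "a \<in> topspace K" "openin L U"
  shows "openin (compact_open_topology K L) {f \<in> mor K L. f a \<in> U}"
  using openin_compact_open[of K "{a}" L U] assms by simp

lemma continuous_map_evaluation:
  assumes "a \<in> topspace K"
  shows "continuous_map (compact_open_topology K L) L (\<lambda>f. f a)"
  using assms openin_evaluation[OF assms]
  by (auto simp: continuous_map_def topspace_compact_open_topology mor_in)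

text \<open>Compact subsets of a finite space are finite, so the preimage of a subbasic set is a
  finite intersection of preimages under the point evaluations of \<open>h\<close>.\<close>

lemma continuous_map_compact_open_finite:
  assumes "finite (topspace K)"
    and "\<And>b. b \<in> topspace B \<Longrightarrow> h b \<in> mor K L"
    and pointwise: "\<And>p. p \<in> topspace K \<Longrightarrow> continuous_map B L (\<lambda>b. h b p)"
  shows "continuous_map B (compact_open_topology K L) h"
proof -
  have "openin B (h -` {f \<in> mor K L. f ` C \<subseteq> U} \<inter> topspace B)"
    if C: "compactin K C" and U: "openin L U" for C U
  proof -
    have sub: "C \<subseteq> topspace K"
      using C compactin_subset_topspace by blast
    then have "finite C"
      using assms(1) finite_subset by blast
    \<comment> \<open>Intersecting with \<open>topspace B\<close> gives the right set also for empty
      \<open>C\<close>, where the indexed intersection is the whole type.\<close>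
    have "openin B (topspace B \<inter> (\<Inter>p\<in>C. {b \<in> topspace B. h b p \<in> U}))"
    proof (cases "C = {}")
      case False
      then have "openin B (\<Inter>p\<in>C. {b \<in> topspace B. h b p \<in> U})"
        using \<open>finite C\<close> sub openin_continuous_map_preimage[OF pointwise U]
        by (intro openin_INT2) auto
      then show ?thesis by blast
    qed simp
    moreover have "h -` {f \<in> mor K L. f ` C \<subseteq> U} \<inter> topspace B
        = topspace B \<inter> (\<Inter>p\<in>C. {b \<in> topspace B. h b p \<in> U})"
      using assms(2) by auto
    ultimately show ?thesis by simp
  qed
  moreover have "h ` topspace B \<subseteq> topspace (compact_open_topology K L)"
    using assms(2) by (auto simp: topspace_compact_open_topology)
  ultimately show ?thesis
    unfolding compact_open_topology_def topology_generated_by_topspace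
    by (intro continuous_on_generated_topo) auto
qed

section \<open>Monads on compact Hausdorff spaces\<close>

locale compact_monad =
  fixes T :: "'u topology \<Rightarrow> 'u topology"
    and Tm :: "'u topology \<Rightarrow> 'u topology \<Rightarrow> ('u \<Rightarrow> 'u) \<Rightarrow> 'u \<Rightarrow> 'u"
    and \<eta> \<mu> :: "'u topology \<Rightarrow> 'u \<Rightarrow> 'u"
  assumes monad: "comp_monad T Tm \<eta> \<mu>"
begin

section \<open>Functor and monad laws in pointwise form\<close>

lemma T_functor: "comp_functor T Tm"
  using monad by (simp add: comp_monad_def)

lemma T_obj [simp]: "comp_object K \<Longrightarrow> comp_object (T K)"
  using T_functor by (simp add: comp_functor_def)

lemma Tm_mor: "comp_object K \<Longrightarrow> comp_object L \<Longrightarrow> f \<in> mor K L \<Longrightarrow> Tm K L f \<in> mor (T K) (T L)"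
  using T_functor unfolding comp_functor_def by blast

lemma Tm_id: "comp_object K \<Longrightarrow> a \<in> topspace (T K) \<Longrightarrow> Tm K K (id_mor K) a = a"
  using T_functor unfolding comp_functor_def by (simp add: id_mor_def)

lemma Tm_compose:
  assumes "comp_object K" "comp_object L" "comp_object M" "f \<in> mor K L" "g \<in> mor L M"
    "a \<in> topspace (T K)"
  shows "Tm K M (compose (topspace K) g f) a = Tm L M g (Tm K L f a)"
proof -
  have "Tm K M (compose (topspace K) g f) = compose (topspace (T K)) (Tm L M g) (Tm K L f)"
    using T_functor assms(1-5) unfolding comp_functor_def by blast
  then show ?thesis
    using assms(6) by (simp add: compose_eq)
qed

lemma unit_mor: "comp_object K \<Longrightarrow> \<eta> K \<in> mor K (T K)"
  using monad by (simp add: comp_monad_def)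

lemma mult_mor: "comp_object K \<Longrightarrow> \<mu> K \<in> mor (T (T K)) (T K)"
  using monad by (simp add: comp_monad_def)

lemma unit_natural:
  assumes "comp_object K" "comp_object L" "f \<in> mor K L" "x \<in> topspace K"
  shows "Tm K L f (\<eta> K x) = \<eta> L (f x)"
proof -
  have "compose (topspace K) (\<eta> L) f = compose (topspace K) (Tm K L f) (\<eta> K)"
    using monad assms(1-3) unfolding comp_monad_def by blast
  then show ?thesis
    by (metis assms(4) compose_eq)
qed

lemma mult_natural:
  assumes "comp_object K" "comp_object L" "f \<in> mor K L" "w \<in> topspace (T (T K))"
  shows "\<mu> L (Tm (T K) (T L) (Tm K L f) w) = Tm K L f (\<mu> K w)"
proof -
  have "compose (topspace (T (T K))) (\<mu> L) (Tm (T K) (T L) (Tm K L f))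
      = compose (topspace (T (T K))) (Tm K L f) (\<mu> K)"
    using monad assms(1-3) unfolding comp_monad_def by blast
  then show ?thesis
    by (metis assms(4) compose_eq)
qed

lemma mult_unit:
  assumes "comp_object K" "a \<in> topspace (T K)"
  shows "\<mu> K (\<eta> (T K) a) = a"
proof -
  have "compose (topspace (T K)) (\<mu> K) (\<eta> (T K)) = id_mor (T K)"
    using monad assms(1) unfolding comp_monad_def by blast
  then show ?thesis
    by (metis assms(2) compose_eq id_apply id_mor_def restrict_apply')
qed

lemma mult_Tm_unit:
  assumes "comp_object K" "a \<in> topspace (T K)"
  shows "\<mu> K (Tm K (T K) (\<eta> K) a) = a"
proof -
  have "compose (topspace (T K)) (\<mu> K) (Tm K (T K) (\<eta> K)) = id_mor (T K)"
    using monad assms(1) unfolding comp_monad_def by blast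
  then show ?thesis
    by (metis assms(2) compose_eq id_apply id_mor_def restrict_apply')
qed

lemma mult_assoc:
  assumes "comp_object K" "w \<in> topspace (T (T (T K)))"
  shows "\<mu> K (\<mu> (T K) w) = \<mu> K (Tm (T (T K)) (T K) (\<mu> K) w)"
proof -
  have "compose (topspace (T (T (T K)))) (\<mu> K) (\<mu> (T K))
      = compose (topspace (T (T (T K)))) (\<mu> K) (Tm (T (T K)) (T K) (\<mu> K))"
    using monad assms(1) unfolding comp_monad_def by blast
  then show ?thesis
    by (metis assms(2) compose_eq)
qed

section \<open>Free algebras and their homomorphisms\<close>

definition kleisli_ext :: "'u topology \<Rightarrow> 'u topology \<Rightarrow> ('u \<Rightarrow> 'u) \<Rightarrow> 'u \<Rightarrow> 'u" where
  "kleisli_ext K L g = compose (topspace (T K)) (\<mu> L) (Tm K (T L) g)"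

text \<open>These are the homomorphisms between the free algebras \<open>(T K, \<mu> K)\<close> and
  \<open>(T L, \<mu> L)\<close> of the monad.\<close>

definition free_hom :: "'u topology \<Rightarrow> 'u topology \<Rightarrow> ('u \<Rightarrow> 'u) \<Rightarrow> bool" where
  "free_hom K L h \<longleftrightarrow> h \<in> mor (T K) (T L) \<and>
     (\<forall>w \<in> topspace (T (T K)). h (\<mu> K w) = \<mu> L (Tm (T K) (T L) h w))"

lemma free_hom_mor: "free_hom K L h \<Longrightarrow> h \<in> mor (T K) (T L)"
  by (simp add: free_hom_def)

lemma free_hom_Tm:
  "comp_object K \<Longrightarrow> comp_object L \<Longrightarrow> f \<in> mor K L \<Longrightarrow> free_hom K L (Tm K L f)"
  by (simp add: free_hom_def Tm_mor mult_natural)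

lemma free_hom_compose:
  assumes "comp_object K" "comp_object L" "comp_object M" "free_hom K L h" "free_hom L M k"
  shows "free_hom K M (compose (topspace (T K)) k h)"
  unfolding free_hom_def
proof (intro conjI ballI)
  show "compose (topspace (T K)) k h \<in> mor (T K) (T M)"
    using assms by (auto simp: free_hom_def intro: mor_compose)
next
  fix w assume w: "w \<in> topspace (T (T K))"
  note h = free_hom_mor[OF assms(4)] and k = free_hom_mor[OF assms(5)]
  have "compose (topspace (T K)) k h (\<mu> K w) = k (h (\<mu> K w))"
    using w assms mor_in[OF mult_mor] by (simp add: compose_eq)
  also have "\<dots> = k (\<mu> L (Tm (T K) (T L) h w))"
    using assms w by (simp add: free_hom_def)
  also have "\<dots> = \<mu> M (Tm (T L) (T M) k (Tm (T K) (T L) h w))"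
    using assms w mor_in[OF Tm_mor[OF _ _ h]] by (simp add: free_hom_def)
  also have "\<dots> = \<mu> M (Tm (T K) (T M) (compose (topspace (T K)) k h) w)"
    using assms w by (simp add: Tm_compose[OF _ _ _ h k])
  finally show "compose (topspace (T K)) k h (\<mu> K w)
      = \<mu> M (Tm (T K) (T M) (compose (topspace (T K)) k h) w)" .
qed

text \<open>Naturality of \<mu> at \<open>g\<close> moves \<open>T g\<close> past
  \<open>\<mu> K\<close>; associativity of \<mu> then exchanges the two multiplications, and
  functoriality recombines the factors.\<close>

lemma free_hom_kleisli_ext:
  assumes "comp_object K" "comp_object L" "g \<in> mor K (T L)"
  shows "free_hom K L (kleisli_ext K L g)"
proof -
  have g: "Tm K (T L) g \<in> mor (T K) (T (T L))"
    using assms by (simp add: Tm_mor)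
  have "kleisli_ext K L g \<in> mor (T K) (T L)"
    unfolding kleisli_ext_def using assms g mult_mor by (intro mor_compose) auto
  moreover have "kleisli_ext K L g (\<mu> K w) = \<mu> L (Tm (T K) (T L) (kleisli_ext K L g) w)"
    if w: "w \<in> topspace (T (T K))" for w
  proof -
    have "kleisli_ext K L g (\<mu> K w) = \<mu> L (Tm K (T L) g (\<mu> K w))"
      unfolding kleisli_ext_def using w assms mor_in[OF mult_mor] by (simp add: compose_eq)
    also have "\<dots> = \<mu> L (\<mu> (T L) (Tm (T K) (T (T L)) (Tm K (T L) g) w))"
      using assms w by (simp add: mult_natural)
    also have "\<dots> = \<mu> L (Tm (T (T L)) (T L) (\<mu> L) (Tm (T K) (T (T L)) (Tm K (T L) g) w))"
      using assms w mor_in[OF Tm_mor[OF _ _ g]] by (intro mult_assoc) auto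
    also have "\<dots> = \<mu> L (Tm (T K) (T L) (kleisli_ext K L g) w)"
      unfolding kleisli_ext_def using assms w by (simp add: Tm_compose[OF _ _ _ g mult_mor])
    finally show ?thesis .
  qed
  ultimately show ?thesis
    by (simp add: free_hom_def)
qed

text \<open>Naturality of \<eta> turns \<open>T g (\<eta> x)\<close> into
  \<open>\<eta> (g x)\<close>, and \<mu> cancels this outer unit.\<close>

lemma kleisli_ext_unit:
  assumes "comp_object K" "comp_object L" "g \<in> mor K (T L)" "x \<in> topspace K"
  shows "kleisli_ext K L g (\<eta> K x) = g x"
  unfolding kleisli_ext_def
  using assms mor_in[OF unit_mor] mor_in[OF assms(3,4)]
  by (simp add: compose_eq unit_natural mult_unit)

text \<open>A homomorphism \<open>h\<close> of free algebras satisfies \<open>h = h \<circ> \<mu> \<circ> T\<eta> = \<mu> \<circ> T(h \<circ> \<eta>)\<close>.\<close>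

lemma free_hom_eqI:
  assumes "comp_object K" "comp_object L" "free_hom K L h" "free_hom K L k"
    and eq: "\<And>x. x \<in> topspace K \<Longrightarrow> h (\<eta> K x) = k (\<eta> K x)"
    and a: "a \<in> topspace (T K)"
  shows "h a = k a"
proof -
  have *: "f a = \<mu> L (Tm K (T L) (compose (topspace K) f (\<eta> K)) a)" if f: "free_hom K L f" for f
  proof -
    have "Tm K (T K) (\<eta> K) a \<in> topspace (T (T K))"
      using assms a mor_in[OF Tm_mor[OF _ _ unit_mor]] by simp
    then have "f a = \<mu> L (Tm (T K) (T L) f (Tm K (T K) (\<eta> K) a))"
      using assms(1) a f unfolding free_hom_def by (metis mult_Tm_unit)
    then show ?thesis
      using assms(1,2) a by (simp add: Tm_compose[OF _ _ _ unit_mor free_hom_mor[OF f]])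
  qed
  have "compose (topspace K) h (\<eta> K) = compose (topspace K) k (\<eta> K)"
    using eq by (auto simp: compose_def)
  then show ?thesis
    using *[OF assms(3)] *[OF assms(4)] by simp
qed

end

section \<open>Stone-Cech extensions\<close>

locale stone_cech_monad = compact_monad T Tm \<eta> \<mu>
  for T :: "'u topology \<Rightarrow> 'u topology"
    and Tm :: "'u topology \<Rightarrow> 'u topology \<Rightarrow> ('u \<Rightarrow> 'u) \<Rightarrow> 'u \<Rightarrow> 'u"
    and \<eta> \<mu> :: "'u topology \<Rightarrow> 'u \<Rightarrow> 'u" +
  fixes \<beta> :: "'u topology \<Rightarrow> 'u topology"
    and \<iota> :: "'u topology \<Rightarrow> 'u \<Rightarrow> 'u"
  assumes universe: "strong_limit_universe TYPE('u)"
    and stone_cech: "stone_cech_choice \<beta> \<iota>"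
begin

lemma sc: "tych_object X \<Longrightarrow> stone_cech_compactification X (\<beta> X) (\<iota> X)"
  using stone_cech by (simp add: stone_cech_choice_def)

lemma beta_obj [simp]: "tych_object X \<Longrightarrow> comp_object (\<beta> X)"
  using sc by (simp add: stone_cech_compactification_def)

lemma embedding_cont: "tych_object X \<Longrightarrow> continuous_map X (\<beta> X) (\<iota> X)"
  using sc[of X] unfolding stone_cech_compactification_def embedding_map_def
  by (meson continuous_map_into_fulltopology homeomorphic_imp_continuous_map)

lemma embedding_in: "tych_object X \<Longrightarrow> x \<in> topspace X \<Longrightarrow> \<iota> X x \<in> topspace (\<beta> X)"
  using continuous_map_image_subset_topspace[OF embedding_cont] by blast

lemma embedding_dense: "tych_object X \<Longrightarrow> \<beta> X closure_of (\<iota> X ` topspace X) = topspace (\<beta> X)"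
  using sc by (simp add: stone_cech_compactification_def)

lemma beta_eqI:
  assumes "tych_object X" "Hausdorff_space K" "continuous_map (\<beta> X) K f" "continuous_map (\<beta> X) K g"
    "\<And>x. x \<in> topspace X \<Longrightarrow> f (\<iota> X x) = g (\<iota> X x)" "p \<in> topspace (\<beta> X)"
  shows "f p = g p"
proof (rule forall_in_closure_of_eq[of p "\<beta> X" "\<iota> X ` topspace X" K f g])
  show "p \<in> \<beta> X closure_of (\<iota> X ` topspace X)"
    using assms(1,6) by (simp add: embedding_dense)
  show "f y = g y" if "y \<in> \<iota> X ` topspace X" for y
    using that assms(5) by blast
qed fact+

text \<open>Homomorphisms are determined on the unit image of \<beta>X, and there, by continuity
  into a Hausdorff space, on the dense copy of \<open>X\<close>. All identities behind associativity
  are proved by this principle.\<close>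

lemma free_hom_beta_eqI:
  assumes "tych_object X" "comp_object L" "free_hom (\<beta> X) L h" "free_hom (\<beta> X) L k"
    and "\<And>x. x \<in> topspace X \<Longrightarrow> h (\<eta> (\<beta> X) (\<iota> X x)) = k (\<eta> (\<beta> X) (\<iota> X x))"
    and "a \<in> topspace (T (\<beta> X))"
  shows "h a = k a"
proof (rule free_hom_eqI[OF _ assms(2-4) _ assms(6)])
  show "comp_object (\<beta> X)" using assms(1) by simp
  fix p assume p: "p \<in> topspace (\<beta> X)"
  note u = mor_cont[OF unit_mor[OF beta_obj[OF assms(1)]]]
  have "(h \<circ> \<eta> (\<beta> X)) p = (k \<circ> \<eta> (\<beta> X)) p"
  proof (rule beta_eqI[OF assms(1) _ _ _ _ p])
    show "Hausdorff_space (T L)" using T_obj[OF assms(2)] by (simp add: comp_object_def)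
    show "continuous_map (\<beta> X) (T L) (h \<circ> \<eta> (\<beta> X))" "continuous_map (\<beta> X) (T L) (k \<circ> \<eta> (\<beta> X))"
      by (rule continuous_map_compose[OF u mor_cont[OF free_hom_mor]], fact assms)+
  qed (simp add: assms(5))
  then show "h (\<eta> (\<beta> X) p) = k (\<eta> (\<beta> X) p)" by simp
qed

text \<open>Unlike \<open>stone_cech_map\<close>, this allows any compact Hausdorff target, such as
  \<open>T (\<beta> Z)\<close>. Membership in \<open>mor\<close> fixes the values outside \<beta>X
  and so makes the description unique.\<close>

definition beta_ext :: "'u topology \<Rightarrow> 'u topology \<Rightarrow> ('u \<Rightarrow> 'u) \<Rightarrow> 'u \<Rightarrow> 'u" where
  "beta_ext X K f = (THE g. g \<in> mor (\<beta> X) K \<and> (\<forall>x \<in> topspace X. g (\<iota> X x) = f x))"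

lemma stone_cech_map_eq_beta_ext: "stone_cech_map \<beta> \<iota> X Y f = beta_ext X (\<beta> Y) (\<lambda>x. \<iota> Y (f x))"
  by (simp add: stone_cech_map_def beta_ext_def)

lemma beta_ext_unique:
  assumes "tych_object X" "comp_object K" "g \<in> mor (\<beta> X) K" "h \<in> mor (\<beta> X) K"
    "\<And>x. x \<in> topspace X \<Longrightarrow> g (\<iota> X x) = h (\<iota> X x)"
  shows "g = h"
proof (rule mor_eqI[OF assms(3,4)])
  have "Hausdorff_space K" using assms(2) by (simp add: comp_object_def)
  then show "g p = h p" if "p \<in> topspace (\<beta> X)" for p
    by (rule beta_eqI[OF assms(1) _ mor_cont[OF assms(3)] mor_cont[OF assms(4)] _ that])
      (simp_all add: assms(5))
qed

text \<open>Existence is the universal property followed by restriction to \<beta>X; uniqueness is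
  density of \<open>X\<close>. Together they justify the definite description.\<close>

lemma beta_ext:
  assumes "tych_object X" "comp_object K" "continuous_map X K f"
  shows "beta_ext X K f \<in> mor (\<beta> X) K \<and> (\<forall>x \<in> topspace X. beta_ext X K f (\<iota> X x) = f x)"
proof -
  obtain g where g: "continuous_map (\<beta> X) K g" "\<forall>x \<in> topspace X. g (\<iota> X x) = f x"
    using sc[OF assms(1)] assms(2,3) unfolding stone_cech_compactification_def by blast
  then have "restrict g (topspace (\<beta> X)) \<in> mor (\<beta> X) K \<and>
      (\<forall>x \<in> topspace X. restrict g (topspace (\<beta> X)) (\<iota> X x) = f x)"
    using embedding_in[OF assms(1)] mor_restrict by simp
  moreover have "g = h" if "g \<in> mor (\<beta> X) K \<and> (\<forall>x \<in> topspace X. g (\<iota> X x) = f x)"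
    "h \<in> mor (\<beta> X) K \<and> (\<forall>x \<in> topspace X. h (\<iota> X x) = f x)" for g h
    using that by (intro beta_ext_unique[OF assms(1,2)]) auto
  ultimately have "\<exists>!g. g \<in> mor (\<beta> X) K \<and> (\<forall>x \<in> topspace X. g (\<iota> X x) = f x)"
    by blast
  then show ?thesis
    unfolding beta_ext_def by (rule theI')
qed

lemma
  assumes "tych_object X" "tych_object Y" "continuous_map X Y f"
  shows stone_cech_map_mor: "stone_cech_map \<beta> \<iota> X Y f \<in> mor (\<beta> X) (\<beta> Y)"
    and stone_cech_map_embedding:
      "x \<in> topspace X \<Longrightarrow> stone_cech_map \<beta> \<iota> X Y f (\<iota> X x) = \<iota> Y (f x)"
proof -
  have "continuous_map X (\<beta> Y) (\<lambda>x. \<iota> Y (f x))"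
    using continuous_map_compose[OF assms(3) embedding_cont[OF assms(2)]] by (simp add: o_def)
  note beta_ext[OF assms(1) beta_obj[OF assms(2)] this]
  then show "stone_cech_map \<beta> \<iota> X Y f \<in> mor (\<beta> X) (\<beta> Y)"
    and "x \<in> topspace X \<Longrightarrow> stone_cech_map \<beta> \<iota> X Y f (\<iota> X x) = \<iota> Y (f x)"
    by (simp_all add: stone_cech_map_eq_beta_ext)
qed

section \<open>The composite functor T\<beta> on morphisms\<close>

definition Tbeta_map :: "'u topology \<Rightarrow> 'u topology \<Rightarrow> ('u \<Rightarrow> 'u) \<Rightarrow> 'u \<Rightarrow> 'u" where
  "Tbeta_map X Y f = Tm (\<beta> X) (\<beta> Y) (stone_cech_map \<beta> \<iota> X Y f)"

lemma free_hom_Tbeta_map: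
  assumes "tych_object X" "tych_object Y" "continuous_map X Y f"
  shows "free_hom (\<beta> X) (\<beta> Y) (Tbeta_map X Y f)"
  unfolding Tbeta_map_def using assms by (intro free_hom_Tm stone_cech_map_mor) auto

lemma Tbeta_map_mor:
  "tych_object X \<Longrightarrow> tych_object Y \<Longrightarrow> continuous_map X Y f
    \<Longrightarrow> Tbeta_map X Y f \<in> mor (T (\<beta> X)) (T (\<beta> Y))"
  by (rule free_hom_mor[OF free_hom_Tbeta_map])

lemma Tbeta_map_unit:
  assumes "tych_object X" "tych_object Y" "continuous_map X Y f" "x \<in> topspace X"
  shows "Tbeta_map X Y f (\<eta> (\<beta> X) (\<iota> X x)) = \<eta> (\<beta> Y) (\<iota> Y (f x))"
  unfolding Tbeta_map_def
  using assms by (simp add: unit_natural stone_cech_map_mor stone_cech_map_embedding embedding_in)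

text \<open>The image of a finite \<open>S\<close> is closed in the Hausdorff space \<beta>D and
  also dense, hence is all of it.\<close>

lemma beta_finite_discrete:
  assumes "finite S"
  shows "tych_object (discrete_topology S)" "topspace (\<beta> (discrete_topology S)) = \<iota> (discrete_topology S) ` S"
proof -
  let ?D = "discrete_topology S"
  show D: "tych_object ?D"
    using universe assms by (rule tych_object_finite_discrete)
  have "\<iota> ?D ` S \<subseteq> topspace (\<beta> ?D)"
    using embedding_in[OF D] by auto
  moreover have "Hausdorff_space (\<beta> ?D)"
    using beta_obj[OF D] by (simp add: comp_object_def)
  ultimately have "\<beta> ?D closure_of (\<iota> ?D ` S) = \<iota> ?D ` S"
    using assms by (simp add: closedin_Hausdorff_finite closure_of_closedin)
  then show "topspace (\<beta> ?D) = \<iota> ?D ` S"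
    using embedding_dense[OF D] by simp
qed

section \<open>Density of the elements of finite support\<close>

text \<open>
  Cover \<open>\<beta>X\<close> by finitely many open \<open>V p\<close> whose closed hulls \<open>W p\<close> lie in \<open>U i\<close> or miss \<open>C i\<close>, for
  each \<open>i\<close>; then \<open>r\<close> sends each \<open>x\<close> to a fixed point of some \<open>V p\<close> containing \<open>x\<close>.
\<close>

lemma finite_approximation_of_identity:
  assumes X: "tych_object X" and "finite I"
    and CU: "\<And>i. i \<in> I \<Longrightarrow> compactin (\<beta> X) (C i) \<and> openin (\<beta> X) (U i) \<and> C i \<subseteq> U i"
  obtains r where "r \<in> topspace X \<rightarrow> topspace X" "finite (r ` topspace X)"
    "\<forall>g \<in> mor (\<beta> X) (\<beta> X). (\<forall>x \<in> topspace X. g (\<iota> X x) = \<iota> X (r x)) \<longrightarrow> (\<forall>i \<in> I. g ` C i \<subseteq> U i)"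
proof -
  let ?B = "\<beta> X"
  have compB: "compact_space ?B" and HB: "Hausdorff_space ?B"
    using beta_obj[OF X] by (simp_all add: comp_object_def)
  have "\<exists>V W. openin ?B V \<and> closedin ?B W \<and> p \<in> V \<and> V \<subseteq> W \<and>
      (\<forall>i \<in> I. (p \<in> C i \<longrightarrow> W \<subseteq> U i) \<and> (p \<notin> C i \<longrightarrow> W \<inter> C i = {}))"
    if p: "p \<in> topspace ?B" for p
  proof -
    \<comment> \<open>The condition that \<open>i\<close> imposes near \<open>p\<close>: stay inside
      \<open>U i\<close> if \<open>p\<close> lies in \<open>C i\<close>, otherwise avoid
      \<open>C i\<close>, which is closed because it is compact in a Hausdorff space.\<close>
    define N where "N i = (if p \<in> C i then U i else topspace ?B - C i)" for i
    have N: "openin ?B (N i) \<and> p \<in> N i" if "i \<in> I" for i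
    proof (cases "p \<in> C i")
      case True
      then show ?thesis
        using CU[OF that] by (auto simp: N_def)
    next
      case False
      have "closedin ?B (C i)"
        using CU[OF that] compactin_imp_closedin[OF HB] by blast
      then show ?thesis
        using False p openin_diff[OF openin_topspace] by (simp add: N_def)
    qed
    have "openin ?B (topspace ?B \<inter> \<Inter>(N ` I))"
    proof (cases "I = {}")
      case False
      then have "openin ?B (\<Inter>(N ` I))"
        using \<open>finite I\<close> N by (intro openin_Inter) auto
      then show ?thesis by blast
    qed simp
    moreover have "p \<in> topspace ?B \<inter> \<Inter>(N ` I)"
      using N p by simp
    \<comment> \<open>Regularity of \<beta>X shrinks the open set just found to a closed
      neighbourhood \<open>W\<close> of \<open>p\<close>.\<close>
    moreover have "neighbourhood_base_of (closedin ?B) ?B"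
      using compact_Hausdorff_imp_regular_space[OF compB HB] by (simp add: neighbourhood_base_of_closedin)
    ultimately obtain V W where VW: "openin ?B V" "closedin ?B W" "p \<in> V" "V \<subseteq> W"
        and W: "W \<subseteq> topspace ?B \<inter> \<Inter>(N ` I)"
      using neighbourhood_base_of[of "closedin ?B" ?B] by metis
    have "(p \<in> C i \<longrightarrow> W \<subseteq> U i) \<and> (p \<notin> C i \<longrightarrow> W \<inter> C i = {})" if "i \<in> I" for i
    proof -
      have "W \<subseteq> N i"
        using W that by blast
      then show ?thesis
        by (cases "p \<in> C i") (auto simp: N_def)
    qed
    with VW show ?thesis
      by (intro exI[of _ V] exI[of _ W]) simp
  qed
  then have "\<forall>p \<in> topspace ?B. \<exists>VW. openin ?B (fst VW) \<and> closedin ?B (snd VW) \<and> p \<in> fst VW \<and>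
      fst VW \<subseteq> snd VW \<and>
      (\<forall>i \<in> I. (p \<in> C i \<longrightarrow> snd VW \<subseteq> U i) \<and> (p \<notin> C i \<longrightarrow> snd VW \<inter> C i = {}))"
    by simp
  from bchoice[OF this] obtain VW where VW: "\<And>p. p \<in> topspace ?B \<Longrightarrow>
      openin ?B (fst (VW p)) \<and> closedin ?B (snd (VW p)) \<and> p \<in> fst (VW p) \<and>
      fst (VW p) \<subseteq> snd (VW p) \<and>
      (\<forall>i \<in> I. (p \<in> C i \<longrightarrow> snd (VW p) \<subseteq> U i) \<and> (p \<notin> C i \<longrightarrow> snd (VW p) \<inter> C i = {}))"
    by blast
  define V W where "V p = fst (VW p)" and "W p = snd (VW p)" for p
  have V: "openin ?B (V p)" "p \<in> V p" "V p \<subseteq> W p" and W: "closedin ?B (W p)"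
    and W_U: "\<And>i. i \<in> I \<Longrightarrow> p \<in> C i \<Longrightarrow> W p \<subseteq> U i"
    and W_C: "\<And>i. i \<in> I \<Longrightarrow> p \<notin> C i \<Longrightarrow> W p \<inter> C i = {}" if "p \<in> topspace ?B" for p
    using VW[OF that] by (simp_all add: V_def W_def)
  have "\<exists>\<F>. finite \<F> \<and> \<F> \<subseteq> V ` topspace ?B \<and> topspace ?B \<subseteq> \<Union>\<F>"
    using compB V(1,2) unfolding compact_space_def by (intro compactinD) auto
  then obtain \<F> where \<F>: "finite \<F>" "\<F> \<subseteq> V ` topspace ?B" "topspace ?B \<subseteq> \<Union>\<F>"
    by blast
  from finite_subset_image[OF \<F>(1,2)]
  obtain P where P: "finite P" "P \<subseteq> topspace ?B" "topspace ?B \<subseteq> \<Union>(V ` P)"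
    using \<F>(3) by blast
  \<comment> \<open>Density of \<open>X\<close> supplies a representative \<open>s p\<close> in each
    of the finitely many sets \<open>V p\<close>.\<close>
  have "\<exists>x. x \<in> topspace X \<and> \<iota> X x \<in> V p" if "p \<in> P" for p
  proof -
    have p: "p \<in> topspace ?B"
      using that P(2) by blast
    then have "p \<in> ?B closure_of (\<iota> X ` topspace X)"
      using embedding_dense[OF X] by simp
    then have "\<exists>y \<in> \<iota> X ` topspace X. y \<in> V p"
      using V(1,2)[OF p] unfolding in_closure_of by blast
    then show ?thesis by blast
  qed
  then obtain s where s: "\<And>p. p \<in> P \<Longrightarrow> s p \<in> topspace X \<and> \<iota> X (s p) \<in> V p"
    by metis
  have "\<exists>p. p \<in> P \<and> \<iota> X x \<in> V p" if "x \<in> topspace X" for x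
    using P(3) embedding_in[OF X that] by blast
  then obtain k where k: "\<And>x. x \<in> topspace X \<Longrightarrow> k x \<in> P \<and> \<iota> X x \<in> V (k x)"
    by metis
  show thesis
  proof (rule that[of "s \<circ> k"])
    show "s \<circ> k \<in> topspace X \<rightarrow> topspace X"
      using s k by auto
    have "(s \<circ> k) ` topspace X \<subseteq> s ` P"
      using k by auto
    then show "finite ((s \<circ> k) ` topspace X)"
      using P(1) finite_surj by blast
  next
    have "g ` C i \<subseteq> U i" if g: "g \<in> mor ?B ?B"
      and gx: "\<And>x. x \<in> topspace X \<Longrightarrow> g (\<iota> X x) = \<iota> X ((s \<circ> k) x)" and i: "i \<in> I" for g i
    proof -
      \<comment> \<open>The fibres of \<open>k\<close> split \<open>X\<close> into finitely many
        pieces, so their closures cover \<beta>X, and \<open>g\<close> is constant on each closure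
        by continuity.\<close>
      define A where "A p = {x \<in> topspace X. k x = p}" for p
      have "\<iota> X ` topspace X = \<Union>((\<lambda>p. \<iota> X ` A p) ` P)"
        using k by (auto simp: A_def)
      then have cl: "topspace ?B = (\<Union>p\<in>P. ?B closure_of (\<iota> X ` A p))"
        using embedding_dense[OF X] closure_of_Union[of "(\<lambda>p. \<iota> X ` A p) ` P" ?B] P(1) by simp
      show "g ` C i \<subseteq> U i"
      proof clarify
        fix q assume q: "q \<in> C i"
        then have "q \<in> topspace ?B"
          using CU[OF i] compactin_subset_topspace by blast
        then obtain p where p: "p \<in> P" "q \<in> ?B closure_of (\<iota> X ` A p)"
          using cl by blast
        then have pB: "p \<in> topspace ?B"
          using P(2) by blast
        have "\<iota> X ` A p \<subseteq> W p"
          using k V(3)[OF pB] by (auto simp: A_def)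
        then have "q \<in> W p"
          using p(2) closure_of_minimal[OF _ W[OF pB]] by blast
        \<comment> \<open>The point \<open>q\<close> lies in both \<open>W p\<close> and
          \<open>C i\<close>, which excludes the case that \<open>W p\<close> misses
          \<open>C i\<close>.\<close>
        then have "W p \<subseteq> U i"
          using W_U[OF pB i] W_C[OF pB i] q by blast
        have "\<iota> X (s p) \<in> topspace ?B"
          using s[OF p(1)] embedding_in[OF X] by blast
        then have "g q = \<iota> X (s p)"
          using forall_in_closure_of_eq[OF p(2) HB mor_cont[OF g], of "\<lambda>_. \<iota> X (s p)"] gx
          by (auto simp: A_def)
        then show "g q \<in> U i"
          using s[OF p(1)] V(3)[OF pB] \<open>W p \<subseteq> U i\<close> by auto
      qed
    qed
    then show "\<forall>g \<in> mor ?B ?B. (\<forall>x \<in> topspace X. g (\<iota> X x) = \<iota> X ((s \<circ> k) x)) \<longrightarrow>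
        (\<forall>i \<in> I. g ` C i \<subseteq> U i)"
      by blast
  qed
qed

lemma finite_support_iff:
  "a \<in> finite_support T Tm \<beta> \<iota> X \<longleftrightarrow> a \<in> topspace (T (\<beta> X)) \<and>
     (\<exists>S f. finite S \<and> f \<in> S \<rightarrow> topspace X \<and>
        a \<in> Tbeta_map (discrete_topology S) X f ` topspace (T (\<beta> (discrete_topology S))))"
  by (simp add: finite_support_def Tbeta_map_def Let_def)

text \<open>Continuity of \<open>T\<close> makes \<open>f \<mapsto> T f a\<close> continuous, with
  value \<open>a\<close> at the identity. Maps near the identity that factor through a finite
  discrete space therefore send \<open>a\<close> to nearby elements of finite support.\<close>

lemma finite_support_dense:
  assumes X: "tych_object X" and discrete: "X = discrete_topology (topspace X)"
    and cont: "continuous_comp_functor T Tm"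
  shows "T (\<beta> X) closure_of (finite_support T Tm \<beta> \<iota> X) = topspace (T (\<beta> X))"
proof -
  let ?B = "\<beta> X"
  note B = beta_obj[OF X]
  have Tcont: "continuous_map (compact_open_topology ?B ?B) (compact_open_topology (T ?B) (T ?B)) (Tm ?B ?B)"
    using cont B by (simp add: continuous_comp_functor_def)
  have "\<exists>y \<in> finite_support T Tm \<beta> \<iota> X. y \<in> O'"
    if a: "a \<in> topspace (T ?B)" and O': "openin (T ?B) O'" "a \<in> O'" for a O'
  proof -
    define \<N> where "\<N> = {f \<in> mor ?B ?B. Tm ?B ?B f a \<in> O'}"
    have "openin (compact_open_topology ?B ?B) \<N>"
      using openin_continuous_map_preimage[OF continuous_map_compose[OF Tcont
          continuous_map_evaluation[OF a]] O'(1)]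
      by (simp add: \<N>_def topspace_compact_open_topology)
    moreover have "id_mor ?B \<in> \<N>"
      using id_mor_mor O' a by (simp add: \<N>_def Tm_id[OF B])
    ultimately obtain I where I: "finite I"
        "\<forall>i \<in> I. compactin ?B (fst i) \<and> openin ?B (snd i) \<and> id_mor ?B ` fst i \<subseteq> snd i"
      and nhd: "\<forall>g \<in> mor ?B ?B. (\<forall>i \<in> I. g ` fst i \<subseteq> snd i) \<longrightarrow> g \<in> \<N>"
      by (rule compact_open_neighbourhood)
    have CU: "compactin ?B (fst i) \<and> openin ?B (snd i) \<and> fst i \<subseteq> snd i" if i: "i \<in> I" for i
    proof -
      have CU: "compactin ?B (fst i) \<and> openin ?B (snd i) \<and> id_mor ?B ` fst i \<subseteq> snd i"
        using I(2) i by blast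
      then have "fst i \<subseteq> topspace ?B"
        using compactin_subset_topspace by blast
      then have "id_mor ?B ` fst i = fst i"
        by (force simp: id_mor_def)
      then show ?thesis
        using CU by simp
    qed
    obtain r where r: "r \<in> topspace X \<rightarrow> topspace X" "finite (r ` topspace X)"
      and approx: "\<forall>g \<in> mor ?B ?B. (\<forall>x \<in> topspace X. g (\<iota> X x) = \<iota> X (r x)) \<longrightarrow>
        (\<forall>i \<in> I. g ` fst i \<subseteq> snd i)"
      by (rule finite_approximation_of_identity[OF X I(1) CU])
    let ?D = "discrete_topology (r ` topspace X)"
    have D: "tych_object ?D"
      using r(2) by (rule beta_finite_discrete)
    \<comment> \<open>Discreteness of \<open>X\<close> enters here: the choice function
      \<open>r\<close> need not respect any other topology.\<close>
    have r_cont: "continuous_map X ?D r"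
      by (subst discrete) (simp add: Pi_iff)
    have incl_cont: "continuous_map ?D X id"
      using r(1) by (auto simp: Pi_iff)
    define h where "h = stone_cech_map \<beta> \<iota> X ?D r"
    define j where "j = stone_cech_map \<beta> \<iota> ?D X id"
    have h: "h \<in> mor ?B (\<beta> ?D)" and j: "j \<in> mor (\<beta> ?D) ?B"
      unfolding h_def j_def using X D r_cont incl_cont by (auto intro: stone_cech_map_mor)
    define g where "g = compose (topspace ?B) j h"
    have g: "g \<in> mor ?B ?B"
      unfolding g_def using h j by (rule mor_compose)
    have "g (\<iota> X x) = \<iota> X (r x)" if "x \<in> topspace X" for x
      using that X D r_cont incl_cont
      by (simp add: g_def compose_eq embedding_in h_def j_def stone_cech_map_embedding)
    then have "g \<in> \<N>"
      using bspec[OF approx g] bspec[OF nhd g] by simp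
    then have "Tm ?B ?B g a \<in> O'"
      by (simp add: \<N>_def)
    have "Tm ?B ?B g a = Tbeta_map ?D X id (Tm ?B (\<beta> ?D) h a)"
      unfolding g_def Tbeta_map_def j_def[symmetric]
      using B beta_obj[OF D] h j a by (simp add: Tm_compose)
    moreover have "Tm ?B (\<beta> ?D) h a \<in> topspace (T (\<beta> ?D))"
      using mor_in[OF Tm_mor[OF B beta_obj[OF D] h] a] .
    moreover have "Tm ?B ?B g a \<in> topspace (T ?B)"
      using mor_in[OF Tm_mor[OF B B g] a] .
    moreover have "id \<in> r ` topspace X \<rightarrow> topspace X"
      using r(1) by auto
    ultimately have "Tm ?B ?B g a \<in> finite_support T Tm \<beta> \<iota> X"
      unfolding finite_support_iff using r(2)
      by (intro conjI exI[of _ "r ` topspace X"] exI[of _ id]) (simp_all only: imageI)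
    then show ?thesis
      using \<open>Tm ?B ?B g a \<in> O'\<close> by blast
  qed
  then have "topspace (T ?B) \<subseteq> T ?B closure_of (finite_support T Tm \<beta> \<iota> X)"
    by (simp add: subset_iff in_closure_of Bex_def)
  then show ?thesis
    by (rule antisym[OF closure_of_subset_topspace])
qed

end

section \<open>The extended operation\<close>

text \<open>Continuous left shifts \<open>\<phi> x\<close> are morphisms to which T\<beta> applies;
  discreteness of \<open>X\<close> allows a family of values indexed by \<open>X\<close> to be
  extended over \<beta>X.\<close>

locale operation_extension = stone_cech_monad T Tm \<eta> \<mu> \<beta> \<iota>
  for T :: "'u topology \<Rightarrow> 'u topology"
    and Tm :: "'u topology \<Rightarrow> 'u topology \<Rightarrow> ('u \<Rightarrow> 'u) \<Rightarrow> 'u \<Rightarrow> 'u"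
    and \<eta> \<mu> :: "'u topology \<Rightarrow> 'u \<Rightarrow> 'u"
    and \<beta> :: "'u topology \<Rightarrow> 'u topology"
    and \<iota> :: "'u topology \<Rightarrow> 'u \<Rightarrow> 'u" +
  fixes X Y Z :: "'u topology"
    and \<phi> :: "'u \<Rightarrow> 'u \<Rightarrow> 'u"
  assumes X: "tych_object X" and Y: "tych_object Y" and Z: "tych_object Z"
    and discrete: "X = discrete_topology (topspace X)"
    and left_cont: "\<And>x. x \<in> topspace X \<Longrightarrow> continuous_map Y Z (\<phi> x)"
begin

text \<open>This is \<open>g\<^sub>b\<close>; its Kleisli extension \<open>ext_op\<close> is
  \<Phi>.\<close>

definition right_ext :: "'u \<Rightarrow> 'u \<Rightarrow> 'u" where
  "right_ext b = beta_ext X (T (\<beta> Z)) (\<lambda>x. Tbeta_map Y Z (\<phi> x) b)"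

definition ext_op :: "'u \<Rightarrow> 'u \<Rightarrow> 'u" where
  "ext_op a b = kleisli_ext (\<beta> X) (\<beta> Z) (right_ext b) a"

lemma left_map: "x \<in> topspace X \<Longrightarrow> Tbeta_map Y Z (\<phi> x) \<in> mor (T (\<beta> Y)) (T (\<beta> Z))"
  using Tbeta_map_mor Y Z left_cont by blast

lemma right_ext:
  assumes "b \<in> topspace (T (\<beta> Y))"
  shows right_ext_mor: "right_ext b \<in> mor (\<beta> X) (T (\<beta> Z))"
    and right_ext_embedding: "x \<in> topspace X \<Longrightarrow> right_ext b (\<iota> X x) = Tbeta_map Y Z (\<phi> x) b"
proof -
  have "continuous_map X (T (\<beta> Z)) (\<lambda>x. Tbeta_map Y Z (\<phi> x) b)"
    using mor_in[OF left_map assms] by (subst discrete) (simp add: Pi_iff)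
  note beta_ext[OF X T_obj[OF beta_obj[OF Z]] this]
  then show "right_ext b \<in> mor (\<beta> X) (T (\<beta> Z))"
    and "x \<in> topspace X \<Longrightarrow> right_ext b (\<iota> X x) = Tbeta_map Y Z (\<phi> x) b"
    by (simp_all add: right_ext_def)
qed

text \<open>Right shifts are Kleisli extensions by construction. Their continuity and, through
  uniqueness of homomorphisms, associativity both rest on this.\<close>

lemma free_hom_ext_op:
  assumes "b \<in> topspace (T (\<beta> Y))"
  shows "free_hom (\<beta> X) (\<beta> Z) (\<lambda>a. ext_op a b)"
  unfolding ext_op_def using X Z assms by (simp add: free_hom_kleisli_ext right_ext_mor)

lemma ext_op_in:
  "a \<in> topspace (T (\<beta> X)) \<Longrightarrow> b \<in> topspace (T (\<beta> Y)) \<Longrightarrow> ext_op a b \<in> topspace (T (\<beta> Z))"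
  using mor_in[OF free_hom_mor[OF free_hom_ext_op]] .

lemma ext_op_unit:
  assumes "x \<in> topspace X" "b \<in> topspace (T (\<beta> Y))"
  shows "ext_op (\<eta> (\<beta> X) (\<iota> X x)) b = Tbeta_map Y Z (\<phi> x) b"
  unfolding ext_op_def
  using X Z assms by (simp add: kleisli_ext_unit right_ext_mor right_ext_embedding embedding_in)

lemma unit_embedding_in:
  "tych_object V \<Longrightarrow> v \<in> topspace V \<Longrightarrow> \<eta> (\<beta> V) (\<iota> V v) \<in> topspace (T (\<beta> V))"
  by (simp add: mor_in[OF unit_mor] embedding_in)

lemma ext_op_extends:
  assumes "x \<in> topspace X" "y \<in> topspace Y"
  shows "ext_op (\<eta> (\<beta> X) (\<iota> X x)) (\<eta> (\<beta> Y) (\<iota> Y y)) = \<eta> (\<beta> Z) (\<iota> Z (\<phi> x y))"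
  using assms by (simp add: ext_op_unit unit_embedding_in[OF Y] Tbeta_map_unit[OF Y Z left_cont])

lemma right_topological_ext_op: "right_topological (T (\<beta> X)) (T (\<beta> Y)) (T (\<beta> Z)) ext_op"
  using mor_cont[OF free_hom_mor[OF free_hom_ext_op]] by (simp add: right_topological_def)

text \<open>The left shift by the unit image of \<open>x\<close> is T\<beta> applied to
  \<open>\<phi> x\<close>, hence continuous.\<close>

lemma unit_in_center:
  assumes "x \<in> topspace X"
  shows "\<eta> (\<beta> X) (\<iota> X x) \<in> topological_center (T (\<beta> X)) (T (\<beta> Y)) (T (\<beta> Z)) ext_op"
  using continuous_map_eq[OF mor_cont[OF left_map[OF assms]], of "ext_op (\<eta> (\<beta> X) (\<iota> X x))"]
    ext_op_unit[OF assms] unit_embedding_in[OF X assms]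
  by (simp add: topological_center_def)

lemma finite_support_in_center:
  assumes cont: "continuous_comp_functor T Tm"
    and a: "a \<in> finite_support T Tm \<beta> \<iota> X"
  shows "a \<in> topological_center (T (\<beta> X)) (T (\<beta> Y)) (T (\<beta> Z)) ext_op"
proof -
  obtain S f c where aB: "a \<in> topspace (T (\<beta> X))" and S: "finite S" and f: "f \<in> S \<rightarrow> topspace X"
    and c: "c \<in> topspace (T (\<beta> (discrete_topology S)))" "a = Tbeta_map (discrete_topology S) X f c"
    using a unfolding finite_support_iff by blast
  let ?D = "discrete_topology S"
  define j where "j = stone_cech_map \<beta> \<iota> ?D X f"
  note D = beta_finite_discrete[OF S]
  note BD = beta_obj[OF D(1)] and BX = beta_obj[OF X] and BZ = beta_obj[OF Z]
  have f_cont: "continuous_map ?D X f"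
    using f by (simp add: Pi_iff)
  have j: "j \<in> mor (\<beta> ?D) (\<beta> X)"
    unfolding j_def using D(1) X f_cont by (rule stone_cech_map_mor)
  \<comment> \<open>Restricting \<open>g\<^sub>b\<close> to the finite space \<beta>D reduces its
    dependence on \<open>b\<close> to finitely many values.\<close>
  define h where "h b = compose (topspace (\<beta> ?D)) (right_ext b) j" for b
  have h: "h b \<in> mor (\<beta> ?D) (T (\<beta> Z))" if "b \<in> topspace (T (\<beta> Y))" for b
    unfolding h_def using j right_ext_mor[OF that] by (rule mor_compose)
  have "continuous_map (T (\<beta> Y)) (compact_open_topology (\<beta> ?D) (T (\<beta> Z))) h"
  proof (rule continuous_map_compact_open_finite)
    show "finite (topspace (\<beta> ?D))"
      using D(2) S by simp
    fix p assume p: "p \<in> topspace (\<beta> ?D)"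
    then obtain d where d: "d \<in> S" "p = \<iota> ?D d"
      using D(2) by auto
    then have fd: "f d \<in> topspace X"
      using f by auto
    \<comment> \<open>At a point coming from \<open>d\<close> in \<open>S\<close>, the value is the
      left shift by the unit image of \<open>f d\<close>, which is continuous in
      \<open>b\<close>.\<close>
    have "h b p = Tbeta_map Y Z (\<phi> (f d)) b" if "b \<in> topspace (T (\<beta> Y))" for b
    proof -
      have "j p = \<iota> X (f d)"
        using d stone_cech_map_embedding[OF D(1) X f_cont, of d] by (simp add: j_def)
      then show ?thesis
        using p that fd by (simp add: h_def compose_eq right_ext_embedding)
    qed
    then show "continuous_map (T (\<beta> Y)) (T (\<beta> Z)) (\<lambda>b. h b p)"
      using continuous_map_eq[OF mor_cont[OF left_map[OF fd]]] by metis
  qed (rule h)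
  moreover have "continuous_map (compact_open_topology (\<beta> ?D) (T (\<beta> Z)))
      (compact_open_topology (T (\<beta> ?D)) (T (T (\<beta> Z)))) (Tm (\<beta> ?D) (T (\<beta> Z)))"
    using cont BD BZ by (simp add: continuous_comp_functor_def)
  moreover have "continuous_map (compact_open_topology (T (\<beta> ?D)) (T (T (\<beta> Z)))) (T (T (\<beta> Z))) (\<lambda>u. u c)"
    using c(1) by (rule continuous_map_evaluation)
  moreover have "continuous_map (T (T (\<beta> Z))) (T (\<beta> Z)) (\<mu> (\<beta> Z))"
    using mult_mor[OF BZ] by (rule mor_cont)
  \<comment> \<open>The left shift by \<open>a\<close> is written as a composite of continuous maps:
    form \<open>h b\<close>, apply \<open>T\<close>, evaluate at \<open>c\<close>, multiply.\<close>
  ultimately have "continuous_map (T (\<beta> Y)) (T (\<beta> Z))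
      (\<mu> (\<beta> Z) \<circ> (\<lambda>u. u c) \<circ> Tm (\<beta> ?D) (T (\<beta> Z)) \<circ> h)"
    by (intro continuous_map_compose)
  moreover have "(\<mu> (\<beta> Z) \<circ> (\<lambda>u. u c) \<circ> Tm (\<beta> ?D) (T (\<beta> Z)) \<circ> h) b = ext_op a b"
    if b: "b \<in> topspace (T (\<beta> Y))" for b
  proof -
    \<comment> \<open>Functoriality splits \<open>T (g\<^sub>b \<circ> j)\<close>, and
      \<open>T j c\<close> is \<open>a\<close>.\<close>
    have "Tm (\<beta> ?D) (T (\<beta> Z)) (h b) c = Tm (\<beta> X) (T (\<beta> Z)) (right_ext b) a"
      unfolding h_def c(2) Tbeta_map_def j_def[symmetric]
      using BD BX T_obj[OF BZ] j right_ext_mor[OF b] c(1) by (rule Tm_compose)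
    then show ?thesis
      using aB by (simp add: ext_op_def kleisli_ext_def compose_eq)
  qed
  ultimately have "continuous_map (T (\<beta> Y)) (T (\<beta> Z)) (ext_op a)"
    by (rule continuous_map_eq)
  then show ?thesis
    using aB by (simp add: topological_center_def)
qed

text \<open>Write \<open>L\<^sub>x = T\<beta>(\<phi> x)\<close> and \<open>R\<^sub>c = \<Phi>(\<cdot>, c)\<close>. Both are homomorphisms of free algebras, so each
  of the identities \<open>L\<^sub>x\<^sub>y = L\<^sub>x L\<^sub>y\<close>, \<open>R\<^sub>c L\<^sub>x = L\<^sub>x R\<^sub>c\<close> and \<open>R\<^sub>c R\<^sub>b = R\<^sub>\<Phi>\<^sub>(\<^sub>b\<^sub>,\<^sub>c\<^sub>)\<close> need only be
  checked on \<open>\<eta>(X)\<close>, where it reduces to the previous one.\<close>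

lemma associative_ext_op:
  assumes eq: "X = Y" "Y = Z" and assoc: "associative_on (topspace X) \<phi>"
  shows "associative_on (topspace (T (\<beta> X))) ext_op"
proof -
  let ?B = "\<beta> X" and ?L = "\<lambda>x. Tbeta_map X X (\<phi> x)" and ?u = "\<lambda>x. \<eta> (\<beta> X) (\<iota> X x)"
  note B = beta_obj[OF X]
  have lc: "continuous_map X X (\<phi> x)" if "x \<in> topspace X" for x
    using left_cont[OF that] eq by simp
  have closed: "\<phi> x y \<in> topspace X" if "x \<in> topspace X" "y \<in> topspace X" for x y
    using continuous_map_image_subset_topspace[OF lc[OF that(1)]] that(2) by blast
  have L: "free_hom ?B ?B (?L x)" if "x \<in> topspace X" for x
    using X X lc[OF that] by (rule free_hom_Tbeta_map)
  have L_unit: "?L x (?u y) = ?u (\<phi> x y)" if "x \<in> topspace X" "y \<in> topspace X" for x y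
    using X X lc[OF that(1)] that(2) by (rule Tbeta_map_unit)
  have R: "free_hom ?B ?B (\<lambda>a. ext_op a c)" if "c \<in> topspace (T ?B)" for c
    using free_hom_ext_op[of c] that eq by simp
  have R_in: "ext_op a c \<in> topspace (T ?B)" if "a \<in> topspace (T ?B)" "c \<in> topspace (T ?B)" for a c
    using ext_op_in[of a c] that eq by simp
  have R_unit: "ext_op (?u x) c = ?L x c" if "x \<in> topspace X" "c \<in> topspace (T ?B)" for x c
    using ext_op_unit[of x c] that eq by simp
  have u_in: "?u x \<in> topspace (T ?B)" if "x \<in> topspace X" for x
    using X that by (rule unit_embedding_in)
  \<comment> \<open>Associativity of \<phi> enters only here, on unit elements; both sides are
    homomorphisms in \<open>c\<close>.\<close>
  have LL: "?L (\<phi> x y) c = ?L x (?L y c)"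
    if x: "x \<in> topspace X" and y: "y \<in> topspace X" and c: "c \<in> topspace (T ?B)" for x y c
  proof -
    have "?L (\<phi> x y) c = compose (topspace (T ?B)) (?L x) (?L y) c"
    proof (rule free_hom_beta_eqI[OF X B L[OF closed[OF x y]] free_hom_compose[OF B B B L[OF y] L[OF x]] _ c])
      fix z assume "z \<in> topspace X"
      then show "?L (\<phi> x y) (?u z) = compose (topspace (T ?B)) (?L x) (?L y) (?u z)"
        using x y assoc by (simp add: compose_eq u_in L_unit closed associative_on_def)
    qed
    then show ?thesis
      using c by (simp add: compose_eq)
  qed
  \<comment> \<open>Both sides are homomorphisms in \<open>b\<close>; for \<open>b\<close> the unit
    image of \<open>y\<close> the claim becomes \<open>LL\<close>.\<close>
  have RL: "ext_op (?L x b) c = ?L x (ext_op b c)"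
    if x: "x \<in> topspace X" and b: "b \<in> topspace (T ?B)" and c: "c \<in> topspace (T ?B)" for x b c
  proof -
    have "compose (topspace (T ?B)) (\<lambda>a. ext_op a c) (?L x) b
        = compose (topspace (T ?B)) (?L x) (\<lambda>a. ext_op a c) b"
    proof (rule free_hom_beta_eqI[OF X B free_hom_compose[OF B B B L[OF x] R[OF c]]
          free_hom_compose[OF B B B R[OF c] L[OF x]] _ b])
      fix y assume "y \<in> topspace X"
      then show "compose (topspace (T ?B)) (\<lambda>a. ext_op a c) (?L x) (?u y)
          = compose (topspace (T ?B)) (?L x) (\<lambda>a. ext_op a c) (?u y)"
        using x c by (simp add: compose_eq u_in L_unit R_unit closed LL)
    qed
    then show ?thesis
      using b by (simp add: compose_eq)
  qed
  have "ext_op (ext_op a b) c = ext_op a (ext_op b c)"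
    if a: "a \<in> topspace (T ?B)" and b: "b \<in> topspace (T ?B)" and c: "c \<in> topspace (T ?B)" for a b c
  proof -
    \<comment> \<open>Now \<open>a\<close> is the variable; at the unit image of \<open>x\<close>
      both left shifts become \<open>?L x\<close>, and \<open>RL\<close> applies.\<close>
    have "compose (topspace (T ?B)) (\<lambda>a. ext_op a c) (\<lambda>a. ext_op a b) a = ext_op a (ext_op b c)"
    proof (rule free_hom_beta_eqI[OF X B free_hom_compose[OF B B B R[OF b] R[OF c]]
          R[OF R_in[OF b c]] _ a])
      fix x assume "x \<in> topspace X"
      then show "compose (topspace (T ?B)) (\<lambda>a. ext_op a c) (\<lambda>a. ext_op a b) (?u x)
          = ext_op (?u x) (ext_op b c)"
        using b c by (simp add: compose_eq u_in R_unit R_in RL)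
    qed
    then show ?thesis
      using a by (simp add: compose_eq)
  qed
  then show ?thesis
    by (simp add: associative_on_def)
qed

end

theorem theorem6p2:
  fixes T :: "'u topology \<Rightarrow> 'u topology"
    and Tm :: "'u topology \<Rightarrow> 'u topology \<Rightarrow> ('u \<Rightarrow> 'u) \<Rightarrow> 'u \<Rightarrow> 'u"
    and \<eta>T \<mu>T :: "'u topology \<Rightarrow> 'u \<Rightarrow> 'u"
    and \<beta> :: "'u topology \<Rightarrow> 'u topology"
    and \<iota> :: "'u topology \<Rightarrow> 'u \<Rightarrow> 'u"
    and X Y Z :: "'u topology"
    and \<phi> :: "'u \<Rightarrow> 'u \<Rightarrow> 'u"
  assumes universe: "strong_limit_universe TYPE('u)"
    and monad: "comp_monad T Tm \<eta>T \<mu>T"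
    and stone_cech: "stone_cech_choice \<beta> \<iota>"
    and tychonoff: "tych_object X" "tych_object Y" "tych_object Z"
    and discrete: "X = discrete_topology (topspace X)"
    and operation: "right_topological X Y Z \<phi>"
    and left_shifts: "topological_center X Y Z \<phi> = topspace X"
  shows "\<exists>\<Phi>.
     right_topological (T (\<beta> X)) (T (\<beta> Y)) (T (\<beta> Z)) \<Phi> \<and>
     (\<forall>x \<in> topspace X. \<forall>y \<in> topspace Y.
        \<Phi> (unit_map \<beta> \<iota> \<eta>T X x) (unit_map \<beta> \<iota> \<eta>T Y y) = unit_map \<beta> \<iota> \<eta>T Z (\<phi> x y)) \<and>
     unit_map \<beta> \<iota> \<eta>T X ` topspace X
       \<subseteq> topological_center (T (\<beta> X)) (T (\<beta> Y)) (T (\<beta> Z)) \<Phi> \<and>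
     (continuous_comp_functor T Tm \<longrightarrow>
        (T (\<beta> X)) closure_of (finite_support T Tm \<beta> \<iota> X) = topspace (T (\<beta> X)) \<and>
        finite_support T Tm \<beta> \<iota> X
          \<subseteq> topological_center (T (\<beta> X)) (T (\<beta> Y)) (T (\<beta> Z)) \<Phi>) \<and>
     (X = Y \<and> Y = Z \<and> associative_on (topspace X) \<phi> \<longrightarrow>
        associative_on (topspace (T (\<beta> X))) \<Phi>)"
proof -
  interpret operation_extension T Tm \<eta>T \<mu>T \<beta> \<iota> X Y Z \<phi>
  proof unfold_locales
    \<comment> \<open>Since the topological center of \<phi> is all of \<open>X\<close>, every left
      shift is continuous.\<close>
    fix x assume "x \<in> topspace X"
    then show "continuous_map Y Z (\<phi> x)"
      using left_shifts by (auto simp: topological_center_def)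
  qed (fact universe monad stone_cech tychonoff discrete)+
  show ?thesis
    using right_topological_ext_op ext_op_extends unit_in_center finite_support_in_center
      finite_support_dense[OF tychonoff(1) discrete] associative_ext_op
    by (intro exI[of _ ext_op]) (auto simp: unit_map_def)
qed

end
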